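(* For all complex numbers $\mu, x$ with $|\mu|<1$ and $|x|<1$, $$\operatorname{Li}_3\left(\frac{(1+\mu)x}{1+x}\right) - \operatorname{Li}_3\left(\frac{x}{1+x}\right) = \sum_{n=1}^{\infty}\left\{\sum_{k=1}^{n}\frac{H_k^-(\mu)}{k}\right\}\frac{(-1)^{n-1}}{n}x^n,$$ where, if needed, the left-hand side is understood via the holomorphic extension of $\operatorname{Li}_3$.
   Context: For $n\ge 1$, $H_n^-(\mu)=\sum_{k=1}^n \frac{(-1)^{k-1}\mu^k}{k}$. The trilogarithm is $\operatorname{Li}_3(z)=\sum_{n=1}^\infty \frac{z^n}{n^3}$ for $|z|\le 1$, extended holomorphically to $\mathbb{C}\setminus[1,\infty)$ (principal branch) when the argument lies outside the closed unit disk. *)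

theory Defs
  imports "HOL-Complex_Analysis.Complex_Analysis"
begin

definition H_minus :: "nat \<Rightarrow> complex \<Rightarrow> complex" where
  "H_minus n \<mu> = (\<Sum>k=1..n. (-1) ^ (k - 1) * \<mu> ^ k / of_nat k)"

definition Li3_series :: "complex \<Rightarrow> complex" where
  "Li3_series z = (\<Sum>n. z ^ Suc n / of_nat (Suc n) ^ 3)"

definition Li3_domain :: "complex set" where
  "Li3_domain = - (complex_of_real ` {1..})"

definition is_Li3_extension :: "(complex \<Rightarrow> complex) \<Rightarrow> bool" where
  "is_Li3_extension F \<longleftrightarrow>
     F holomorphic_on Li3_domain \<and> (\<forall>z\<in>ball 0 1. F z = Li3_series z)"

(* The choice is unique on the slit plane and such a function exists: see the lemmas
   is_Li3_extension_unique and is_Li3_extension_Li3_extension below.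
   On the slit itself (outside the closed unit disk) the value is irrelevant. *)
definition Li3_extension :: "complex \<Rightarrow> complex" where
  "Li3_extension = (SOME F. is_Li3_extension F)"

definition Li3 :: "complex \<Rightarrow> complex" where
  "Li3 z = (if norm z \<le> 1 then Li3_series z else Li3_extension z)"

lemma open_Li3_domain: "open Li3_domain"
proof -
  have "closed (complex_of_real ` {1..})"
    by (intro closed_injective_linear_image linear_of_real) (auto simp: inj_on_def)
  then show ?thesis
    by (simp add: Li3_domain_def open_Compl)
qed

lemma starlike_Li3_domain: "starlike Li3_domain"
  unfolding Li3_domain_def by (rule starlike_slotted_complex_plane_right)

lemma ball_subset_Li3_domain: "ball 0 1 \<subseteq> Li3_domain"
  by (auto simp: Li3_domain_def)

lemma is_Li3_extension_unique:
  assumes F: "is_Li3_extension F" and G: "is_Li3_extension G" and z: "z \<in> Li3_domain"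
  shows "F z = G z"
proof -
  have conn: "connected Li3_domain"
    using starlike_Li3_domain starlike_imp_connected by blast
  show ?thesis
  proof (rule analytic_continuation_open[of "ball 0 1" Li3_domain F G z])
  qed (use assms conn open_Li3_domain ball_subset_Li3_domain in
      \<open>auto simp: is_Li3_extension_def\<close>)
qed

lemma summable_polylog_series:
  fixes z :: complex
  assumes "norm z < 1"
  shows "summable (\<lambda>n. 1 / of_nat n ^ p * z ^ n)"
proof (rule summable_comparison_test')
  show "summable (\<lambda>n. norm z ^ n)"
    using assms by (simp add: summable_geometric)
  fix n :: nat
  assume n: "n \<ge> 1"
  have "1 \<le> real n ^ p"
    using n by simp
  then have "1 / real n ^ p \<le> 1"
    using n by (simp add: divide_le_eq_1)
  then have "1 / real n ^ p * norm z ^ n \<le> 1 * norm z ^ n"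
    by (intro mult_right_mono) auto
  then show "norm (1 / of_nat n ^ p * z ^ n) \<le> norm z ^ n"
    by (simp add: norm_mult norm_divide norm_power)
qed

lemma polylog_series_extends:
  "\<exists>F. F holomorphic_on Li3_domain \<and>
     (\<forall>z\<in>ball 0 1. F z = (\<Sum>n. 1 / of_nat n ^ Suc p * z ^ n))"
proof (induction p)
  case 0
  have "(\<lambda>z. - ln (1 - z)) holomorphic_on Li3_domain"
  proof (intro holomorphic_intros)
    fix z assume z: "z \<in> Li3_domain"
    show "1 - z \<notin> \<real>\<^sub>\<le>\<^sub>0"
    proof
      assume "1 - z \<in> \<real>\<^sub>\<le>\<^sub>0"
      then obtain r where r: "1 - z = of_real r" "r \<le> 0"
        by (auto elim: nonpos_Reals_cases)
      then have "z = of_real (1 - r)"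
        by (simp add: algebra_simps)
      then show False
        using z r(2) imageI[of "1 - r" "{1..}" complex_of_real]
        by (simp add: Li3_domain_def)
    qed
  qed
  moreover have "- ln (1 - z) = (\<Sum>n. 1 / of_nat n ^ Suc 0 * z ^ n)"
    if "z \<in> ball 0 1" for z :: complex
  proof -
    have "(\<lambda>n. - ((- (-z)) ^ n) / of_nat n) sums ln (1 + (-z))"
      using that by (intro Ln_series') auto
    from sums_minus[OF this] have "(\<lambda>n. 1 / of_nat n ^ Suc 0 * z ^ n) sums (- ln (1 - z))"
      by simp
    then show ?thesis
      by (simp add: sums_iff)
  qed
  ultimately show ?case
    by blast
next
  case (Suc p)
  define c where "c = (\<lambda>p n. 1 / of_nat n ^ Suc p :: complex)"
  define S where "S = (\<lambda>p z. \<Sum>n. c p n * z ^ n)"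
  from Suc obtain F where F: "F holomorphic_on Li3_domain"
    and F_eq: "\<And>z. z \<in> ball 0 1 \<Longrightarrow> F z = S p z"
    unfolding S_def c_def by blast
  have DS: "(S q has_field_derivative (\<Sum>n. diffs (c q) n * z ^ n)) (at z)"
    if "z \<in> ball 0 1" for q z
    unfolding S_def
    by (rule termdiffs_strong'[where K = 1])
      (use that summable_polylog_series in \<open>auto simp: c_def simp del: power_Suc\<close>)
  have S_0: "S q 0 = 0" for q
    by (simp add: S_def powser_zero) (simp add: c_def)
  have F_0: "F 0 = 0"
    using F_eq[of 0] S_0 by simp
  define G where "G = (\<lambda>z. if z = 0 then deriv F 0 else (F z - F 0) / (z - 0))"
  have G: "G holomorphic_on Li3_domain"
    unfolding G_def by (intro pole_lemma_open F open_Li3_domain)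
  have "\<exists>H. \<forall>z\<in>Li3_domain. (H has_field_derivative G z) (at z)"
    by (rule holomorphic_starlike_primitive[where k = "{}"])
      (use G starlike_Li3_domain open_Li3_domain in
        \<open>auto intro: holomorphic_on_imp_continuous_on holomorphic_on_imp_differentiable_at\<close>)
  then obtain H where H: "\<And>z. z \<in> Li3_domain \<Longrightarrow> (H has_field_derivative G z) (at z)"
    by blast
  have diffs_c: "diffs (c (Suc p)) n = c p (Suc n)" for n
    by (simp add: diffs_def c_def divide_simps del: of_nat_Suc)
  have G_eq: "G z = (\<Sum>n. diffs (c (Suc p)) n * z ^ n)" if z: "z \<in> ball 0 1" for z
  proof (cases "z = 0")
    case True
    have "(F has_field_derivative (\<Sum>n. diffs (c p) n * 0 ^ n)) (at 0)"
      by (rule DERIV_cong_ev[THEN iffD2, OF refl _ refl DS])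
        (auto intro!: eventually_nhds_in_open[of "ball 0 1", THEN eventually_mono] F_eq)
    then have "deriv F 0 = (\<Sum>n. diffs (c p) n * 0 ^ n)"
      by (rule DERIV_imp_deriv)
    also have "\<dots> = 1"
      by (simp add: diffs_def c_def)
    finally show ?thesis
      using True by (simp add: G_def diffs_c) (simp add: c_def)
  next
    case False
    have "summable (\<lambda>n. c p n * z ^ n)"
      using z summable_polylog_series[of z "Suc p"] by (simp add: c_def)
    then have "(\<Sum>n. c p (Suc n) * z ^ n) * z = S p z"
      using powser_split_head(2)[of "c p" z] by (simp add: S_def c_def)
    then show ?thesis
      using False z F_0 F_eq by (simp add: G_def diffs_c field_simps)
  qed
  have "\<exists>k. \<forall>z\<in>ball 0 1. H z - S (Suc p) z = k"
  proof (rule has_field_derivative_zero_constant)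
    fix z :: complex assume z: "z \<in> ball 0 1"
    have "((\<lambda>z. H z - S (Suc p) z) has_field_derivative 0) (at z)"
      by (rule derivative_eq_intros H DS z subsetD[OF ball_subset_Li3_domain] refl)+
        (simp add: G_eq[OF z])
    then show "((\<lambda>z. H z - S (Suc p) z) has_field_derivative 0) (at z within ball 0 1)"
      by (rule has_field_derivative_at_within)
  qed auto
  then obtain k where k: "\<And>z. z \<in> ball 0 1 \<Longrightarrow> H z - S (Suc p) z = k"
    by blast
  have "(\<lambda>z. H z - k) holomorphic_on Li3_domain"
    using H open_Li3_domain by (intro holomorphic_intros) (auto simp: holomorphic_on_open)
  moreover have "H z - k = S (Suc p) z" if "z \<in> ball 0 1" for z
    using k[OF that] by (simp add: algebra_simps)
  ultimately show ?case
    unfolding S_def c_def by blast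
qed

lemma is_Li3_extension_Li3_extension: "is_Li3_extension Li3_extension"
proof -
  obtain F where F: "F holomorphic_on Li3_domain"
    and F_eq: "\<And>z. z \<in> ball 0 1 \<Longrightarrow> F z = (\<Sum>n. 1 / of_nat n ^ Suc 2 * z ^ n)"
    using polylog_series_extends[of 2] by blast
  have "F z = Li3_series z" if z: "z \<in> ball 0 1" for z
  proof -
    have "summable (\<lambda>n. 1 / of_nat n ^ Suc 2 * z ^ n)"
      using z by (intro summable_polylog_series) auto
    from suminf_split_head[OF this]
    have "(\<Sum>n. 1 / of_nat (Suc n) ^ Suc 2 * z ^ Suc n) = (\<Sum>n. 1 / of_nat n ^ Suc 2 * z ^ n)"
      by simp
    then show ?thesis
      using F_eq[OF z] by (simp add: Li3_series_def eval_nat_numeral)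
  qed
  then have "is_Li3_extension F"
    using F by (simp add: is_Li3_extension_def)
  then show ?thesis
    unfolding Li3_extension_def by (rule someI[where P = is_Li3_extension])
qed

end

theory Submission
  imports Defs
begin

text \<open>
  On the slit plane the polylogarithms satisfy $z\,\mathrm{Li}_{p+1}'(z) = \mathrm{Li}_p(z)$. For
  a branch $A$ of $\mathrm{Li}_p$ put
  \[ \Phi_A(x) = A\Bigl(\frac{(1+\mu)x}{1+x}\Bigr) - A\Bigl(\frac{x}{1+x}\Bigr). \]
  Both arguments have the form $w = cx/(1+x)$, for which $x(1+x)\,w'(x) = w(x)$. Hence the operator
  $x(1+x)\,d/dx$ maps $\Phi_{\mathrm{Li}_{p+1}}$ to $\Phi_{\mathrm{Li}_p}$.

  At the level of coefficients this operator is easy to invert. If $x(1+x)f'(x) = \sum_n d_n x^n$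
  and $f(x) = \sum_n c_n x^n$ with $c_0 = 0$, then $n c_n + (n-1)c_{n-1} = d_n$; multiplying by
  $(-1)^{n-1}$ makes the left side telescope, and
  \[ c_n = \frac{(-1)^{n-1}}{n}\sum_{k=1}^n (-1)^{k-1} d_k \]
  (\<open>has_fps_expansion_solve_euler\<close>). The starting point is
  $\Phi_{\mathrm{Li}_1}(x) = -\ln(1-\mu x) = \sum_n \mu^n x^n/n$, because the factors $1+x$ cancel
  (\<open>log_moebius_diff_expansion\<close>). One inversion gives the coefficients
  $(-1)^{n-1}H_n^-(\mu)/n$ of $\Phi_{\mathrm{Li}_2}$; in the next one the signs cancel and the
  asserted coefficients of $\Phi_{\mathrm{Li}_3}$ appear.

  Coefficient comparison takes place in a neighbourhood of $0$ only. The expansion converges on the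
  whole unit disc because $\Phi_{\mathrm{Li}_3}$ is holomorphic there: neither argument meets the
  slit $[1,\infty)$ (\<open>moebius_in_Li3_domain\<close>). The arguments may well leave the unit disc
  or lie on its boundary, so it also has to be known that the two cases in the definition of
  \<^const>\<open>Li3\<close> fit together along the unit circle (\<open>Li3_eq_extension\<close>).
\<close>

section \<open>Polylogarithms on the slit plane\<close>

text \<open>
  Since the slit plane is connected, the expansion at $0$ determines the function. For $p > 0$ the
  convention $1/0 = 0$ gives the constant coefficient the correct value $0$.
\<close>

definition polylog_branch :: "nat \<Rightarrow> (complex \<Rightarrow> complex) \<Rightarrow> bool" where
  "polylog_branch p F \<longleftrightarrow>
     F holomorphic_on Li3_domain \<and> F has_fps_expansion Abs_fps (\<lambda>n. 1 / of_nat n ^ p)"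

lemma polylog_branch_ex: "\<exists>F. polylog_branch (Suc p) F"
proof -
  obtain F where F: "F holomorphic_on Li3_domain"
    and F_eq: "\<And>z. z \<in> ball 0 1 \<Longrightarrow> F z = (\<Sum>n. 1 / of_nat n ^ Suc p * z ^ n)"
    using polylog_series_extends[of p] by blast
  have "F has_fps_expansion Abs_fps (\<lambda>n. 1 / of_nat n ^ Suc p)"
  proof (rule has_fps_expansionI)
    have "eventually (\<lambda>z. z \<in> ball 0 1) (nhds (0::complex))"
      by (intro eventually_nhds_in_open) auto
    then show "\<forall>\<^sub>F z in nhds 0. (\<lambda>n. fps_nth (Abs_fps (\<lambda>n. 1 / of_nat n ^ Suc p)) n * z ^ n) sums F z"
    proof eventually_elim
      case (elim z)
      then show ?case
        using summable_sums[OF summable_polylog_series[of z "Suc p"]] F_eq[OF elim] by simp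
    qed
  qed
  then show ?thesis
    using F by (auto simp: polylog_branch_def)
qed

lemma polylog_branch_Li3_extension: "polylog_branch 3 Li3_extension"
proof -
  obtain F where F: "polylog_branch 3 F"
    using polylog_branch_ex[of 2] by (auto simp: numeral_3_eq_3 numeral_2_eq_2)
  have hol: "F holomorphic_on ball 0 1"
    using F ball_subset_Li3_domain holomorphic_on_subset by (auto simp: polylog_branch_def)
  have "is_Li3_extension F"
    unfolding is_Li3_extension_def
  proof (intro conjI ballI)
    show "F holomorphic_on Li3_domain"
      using F by (simp add: polylog_branch_def)
    fix z :: complex assume z: "z \<in> ball 0 1"
    have "(\<lambda>n. fps_nth (Abs_fps (\<lambda>n. 1 / of_nat n ^ 3)) n * z ^ n) sums F z"
      by (rule has_fps_expansion_imp_sums_complex[where r = 1])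
        (use F z hol in \<open>auto simp: polylog_branch_def eball_def ball_def dist_norm\<close>)
    then have "(\<lambda>n. z ^ n / of_nat n ^ 3) sums F z"
      by simp
    then have "(\<lambda>n. z ^ Suc n / of_nat (Suc n) ^ 3) sums F z"
      by (subst sums_Suc_iff) simp
    then show "F z = Li3_series z"
      unfolding Li3_series_def by (rule sums_unique)
  qed
  then have eq: "F z = Li3_extension z" if "z \<in> ball 0 1" for z
    using is_Li3_extension_Li3_extension that by (auto simp: is_Li3_extension_def)
  have "\<forall>\<^sub>F z in nhds 0. F z = Li3_extension z"
    using eventually_nhds_in_open[of "ball 0 1" "0::complex"] eq by (auto elim: eventually_mono)
  then have "Li3_extension has_fps_expansion Abs_fps (\<lambda>n. 1 / of_nat n ^ 3)"
    using F has_fps_expansion_cong polylog_branch_def by blast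
  then show ?thesis
    using is_Li3_extension_Li3_extension by (simp add: polylog_branch_def is_Li3_extension_def)
qed

lemma one_minus_notin_nonpos_Reals:
  assumes "z \<in> Li3_domain"
  shows "1 - z \<notin> \<real>\<^sub>\<le>\<^sub>0"
proof
  assume "1 - z \<in> \<real>\<^sub>\<le>\<^sub>0"
  then obtain r where r: "1 - z = of_real r" "r \<le> 0"
    by (auto elim: nonpos_Reals_cases)
  then have "z = of_real (1 - r)"
    by (simp add: algebra_simps)
  then show False
    using assms r(2) imageI[of "1 - r" "{1..}" complex_of_real]
    by (simp add: Li3_domain_def)
qed

lemma polylog_branch_1: "polylog_branch 1 (\<lambda>z. - ln (1 - z))"
  unfolding polylog_branch_def
proof
  show "(\<lambda>z. - ln (1 - z)) holomorphic_on Li3_domain"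
    using one_minus_notin_nonpos_Reals by (intro holomorphic_intros) auto
  show "(\<lambda>z::complex. - ln (1 - z)) has_fps_expansion Abs_fps (\<lambda>n. 1 / of_nat n ^ 1)"
  proof (rule has_fps_expansionI)
    have "eventually (\<lambda>z. z \<in> ball 0 1) (nhds (0::complex))"
      by (intro eventually_nhds_in_open) auto
    then show "\<forall>\<^sub>F z::complex in nhds 0.
        (\<lambda>n. fps_nth (Abs_fps (\<lambda>n. 1 / of_nat n ^ 1)) n * z ^ n) sums - ln (1 - z)"
    proof eventually_elim
      case (elim z)
      then show ?case
        using sums_minus[OF Ln_series'[of "-z"]] by simp
    qed
  qed
qed

text \<open>
  The coefficients $1/n^{p+1}$ become $1/n^p$ under $z\,d/dz$, so both sides agree near $0$, and
  therefore on the connected slit plane. For $p = 0$ the constant coefficients would differ, since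
  $1/0^0 = 1$.
\<close>

lemma polylog_branch_deriv:
  assumes A: "polylog_branch (Suc p) A" and B: "polylog_branch p B" and "p > 0"
    and z: "z \<in> Li3_domain"
  shows "z * deriv A z = B z"
proof -
  let ?P = "\<lambda>p. Abs_fps (\<lambda>n. 1 / of_nat n ^ p) :: complex fps"
  have "fps_X * fps_deriv (?P (Suc p)) = ?P p"
  proof (rule fps_ext)
    show "fps_nth (fps_X * fps_deriv (?P (Suc p))) n = fps_nth (?P p) n" for n
      using \<open>p > 0\<close> by (cases n) (simp_all del: of_nat_Suc)
  qed
  then have "(\<lambda>z. z * deriv A z) has_fps_expansion ?P p"
    using A has_fps_expansion_mult[OF has_fps_expansion_fps_X has_fps_expansion_deriv[of A "?P (Suc p)"]]
    by (simp add: polylog_branch_def)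
  then have "\<forall>\<^sub>F z in nhds 0. z * deriv A z = B z"
    using B unfolding polylog_branch_def has_fps_expansion_def
    by (auto elim: eventually_elim2)
  then obtain U where U: "open U" "0 \<in> U" "\<And>z. z \<in> U \<Longrightarrow> z * deriv A z = B z"
    by (auto simp: eventually_nhds)
  have "0 \<in> Li3_domain"
    using ball_subset_Li3_domain by auto
  show ?thesis
  proof (rule analytic_continuation_open[of "U \<inter> Li3_domain" Li3_domain "\<lambda>z. z * deriv A z" B z])
    show "connected Li3_domain"
      using starlike_Li3_domain starlike_imp_connected by blast
    show "(\<lambda>z. z * deriv A z) holomorphic_on Li3_domain"
      using A open_Li3_domain by (auto simp: polylog_branch_def intro!: holomorphic_intros)
  qed (use B U z open_Li3_domain \<open>0 \<in> Li3_domain\<close> in \<open>auto simp: polylog_branch_def\<close>)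
qed

text \<open>
  Only the unit circle needs an argument. The series converges uniformly on the closed disc, by
  comparison with $\sum 1/n^3$, so it is continuous there; off the point $1$ the extension is
  continuous as well, and the two agree inside the disc.
\<close>

lemma Li3_eq_extension:
  assumes z: "z \<in> Li3_domain"
  shows "Li3 z = Li3_extension z"
proof (cases "norm z \<le> 1")
  case True
  have summ: "summable (\<lambda>n. 1 / real (Suc n) ^ 3)"
    using inverse_power_summable[of 3, where 'a = real]
    by (subst summable_Suc_iff) (simp add: inverse_eq_divide)
  have "uniform_limit (cball 0 1) (\<lambda>N z. \<Sum>n<N. z ^ Suc n / of_nat (Suc n) ^ 3) Li3_series sequentially"
    unfolding Li3_series_def
  proof (rule Weierstrass_m_test[OF _ summ])
    fix n and z :: complex assume "z \<in> cball 0 1"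
    then have "norm z ^ Suc n \<le> 1"
      by (intro power_le_one) auto
    then show "norm (z ^ Suc n / of_nat (Suc n) ^ 3) \<le> 1 / real (Suc n) ^ 3"
      unfolding norm_divide norm_power norm_of_nat by (intro divide_right_mono) auto
  qed
  then have cont: "continuous_on (cball 0 1) Li3_series"
    by (rule uniform_limit_theorem[rotated])
      (auto intro!: always_eventually continuous_intros simp del: of_nat_Suc)
  have "continuous_on (insert z (ball 0 1)) (\<lambda>w. Li3_extension w - Li3_series w)"
  proof (intro continuous_on_diff)
    show "continuous_on (insert z (ball 0 1)) Li3_extension"
      using is_Li3_extension_Li3_extension z ball_subset_Li3_domain
      by (auto simp: is_Li3_extension_def
          intro: continuous_on_subset[OF holomorphic_on_imp_continuous_on])
    show "continuous_on (insert z (ball 0 1)) Li3_series"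
      by (rule continuous_on_subset[OF cont]) (use True in auto)
  qed
  then have lim: "((\<lambda>w. Li3_extension w - Li3_series w) \<longlongrightarrow> Li3_extension z - Li3_series z)
      (at z within ball 0 1)"
    by (auto simp: continuous_on_def intro: tendsto_within_subset)
  have "\<forall>\<^sub>F w in at z within ball 0 1. Li3_extension w - Li3_series w = 0"
    using is_Li3_extension_Li3_extension
    by (auto simp: is_Li3_extension_def eventually_at_filter)
  then have "((\<lambda>w. Li3_extension w - Li3_series w) \<longlongrightarrow> 0) (at z within ball 0 1)"
    by (rule tendsto_eventually)
  moreover have "at z within ball 0 1 \<noteq> bot"
    using True by (simp add: trivial_limit_within islimpt_ball)
  ultimately have "Li3_extension z - Li3_series z = 0"
    using lim tendsto_unique by blast
  then show ?thesis
    using True by (simp add: Li3_def)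
qed (simp add: Li3_def)

section \<open>The substitution $x \mapsto cx/(1+x)$\<close>

text \<open>
  If the quotient were a real number $r \ge 1$, then $1 - \mu x = (1-r)(1+x)$ would have real part
  at most $0$, although $|\mu x| < 1$.
\<close>

lemma moebius_in_Li3_domain:
  fixes \<mu> x :: complex
  assumes \<mu>: "norm \<mu> < 1" and x: "norm x < 1"
  shows "(1 + \<mu>) * x / (1 + x) \<in> Li3_domain"
proof (rule ccontr)
  assume "(1 + \<mu>) * x / (1 + x) \<notin> Li3_domain"
  then obtain r where r: "(1 + \<mu>) * x / (1 + x) = of_real r" "r \<ge> 1"
    by (auto simp: Li3_domain_def)
  have pos: "Re (1 + x) > 0"
    using abs_Re_le_cmod[of x] x by simp
  then have nz: "1 + x \<noteq> 0"
    by (metis less_irrefl zero_complex.simps(1))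
  have "1 - \<mu> * x = of_real (1 - r) * (1 + x)"
    using r(1) nz by (simp add: field_simps)
  then have "Re (1 - \<mu> * x) = (1 - r) * Re (1 + x)"
    by (metis Re_complex_of_real Im_complex_of_real times_complex.simps(1) mult_zero_left diff_zero)
  also have "\<dots> \<le> 0"
    using r(2) pos by (intro mult_nonpos_nonneg) auto
  finally have "1 \<le> Re (\<mu> * x)"
    by simp
  also have "\<dots> \<le> norm (\<mu> * x)"
    by (rule complex_Re_le_cmod)
  also have "\<dots> < 1"
    using mult_strict_mono'[OF \<mu> x] by (simp add: norm_mult)
  finally show False
    by simp
qed

lemma moebius_has_field_derivative:
  fixes c x :: complex
  assumes "(A has_field_derivative A') (at (c * x / (1 + x)))" and "1 + x \<noteq> 0"
  shows "((\<lambda>x. A (c * x / (1 + x))) has_field_derivative (A' * (c / (1 + x)\<^sup>2))) (at x)"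
proof -
  have "((\<lambda>x. c * x / (1 + x)) has_field_derivative c / (1 + x)\<^sup>2) (at x)"
    using assms(2)
    by (auto intro!: derivative_eq_intros simp: field_simps power2_eq_square)
  from DERIV_chain'[OF this assms(1)] show ?thesis
    by (simp add: mult.commute)
qed

section \<open>Inverting the operator $x(1+x)\,d/dx$ on power series\<close>

text \<open>
  Comparing coefficients of $x^{n+1}$ gives $(n+1)c_{n+1} + n c_n = d_{n+1}$, where $c$ and $d$ are
  the coefficients of \<open>f\<close> and \<open>g\<close>. The solution follows by induction, since
  $(-1)^n (n+1)c_{n+1}$ is the partial sum of the $(-1)^k d_{k+1}$.
\<close>

lemma has_fps_expansion_solve_euler:
  assumes hol: "f holomorphic_on ball 0 r" and "r > 0" and f0: "f 0 = 0"
    and g: "g has_fps_expansion G"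
    and ode: "\<And>x. x \<in> ball 0 r \<Longrightarrow> x * (1 + x) * deriv f x = g x"
  shows "f has_fps_expansion
           Abs_fps (\<lambda>n. (-1) ^ (n - 1) / of_nat n * (\<Sum>k=1..n. (-1) ^ (k - 1) * fps_nth G k))"
proof -
  define F where "F = fps_expansion f 0"
  have F: "f has_fps_expansion F"
    unfolding F_def using hol \<open>r > 0\<close> by (intro has_fps_expansion_fps_expansion[of "ball 0 r"]) auto
  have F0: "fps_nth F 0 = 0"
    using F f0 by (simp add: F_def fps_expansion_def)
  have "(\<lambda>x. x * (1 + x) * deriv f x) has_fps_expansion fps_X * (1 + fps_X) * fps_deriv F"
    by (intro has_fps_expansion_mult has_fps_expansion_add has_fps_expansion_deriv
        has_fps_expansion_fps_X has_fps_expansion_1 F)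
  moreover have "\<forall>\<^sub>F x in nhds 0. x * (1 + x) * deriv f x = g x"
    by (rule eventually_mono[OF eventually_nhds_in_open[of "ball 0 r"] ode])
      (use \<open>r > 0\<close> in auto)
  ultimately have "g has_fps_expansion fps_X * (1 + fps_X) * fps_deriv F"
    using has_fps_expansion_cong[OF _ refl] by metis
  with g have G: "G = fps_X * (1 + fps_X) * fps_deriv F"
    by (rule fps_expansion_unique_complex)
  have rec: "fps_nth G (Suc n) = of_nat (Suc n) * fps_nth F (Suc n) + of_nat n * fps_nth F n" for n
    unfolding G by (cases n) (simp_all add: algebra_simps del: of_nat_Suc)
  have "of_nat n * fps_nth F n = (-1) ^ (n - 1) * (\<Sum>k=1..n. (-1) ^ (k - 1) * fps_nth G k)" for n
  proof (induction n)
    case 0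
    then show ?case by simp
  next
    case (Suc n)
    have sq: "(-1) ^ n * ((-1) ^ n * a) = (a::complex)" for a
      by (simp flip: mult.assoc power_mult_distrib)
    \<comment> \<open>At $n = 0$ the truncated exponent \<open>n - 1\<close> has the wrong parity, but the sum is empty.\<close>
    have "(-1) ^ (n - 1) * S = - ((-1) ^ n * S)" if "n = 0 \<Longrightarrow> S = 0" for S :: complex
      using that by (cases n) auto
    then have IH: "of_nat n * fps_nth F n = - ((-1) ^ n * (\<Sum>k=1..n. (-1) ^ (k - 1) * fps_nth G k))"
      unfolding Suc.IH by fastforce
    have "of_nat (Suc n) * fps_nth F (Suc n) = fps_nth G (Suc n) - of_nat n * fps_nth F n"
      using rec[of n] by (simp del: of_nat_Suc)
    then show ?case
      unfolding IH by (simp add: algebra_simps sq del: of_nat_Suc)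
  qed
  then have "fps_nth F n = (-1) ^ (n - 1) / of_nat n * (\<Sum>k=1..n. (-1) ^ (k - 1) * fps_nth G k)" for n
    using F0 by (cases "n = 0") (simp_all add: field_simps)
  then have "F = Abs_fps (\<lambda>n. (-1) ^ (n - 1) / of_nat n * (\<Sum>k=1..n. (-1) ^ (k - 1) * fps_nth G k))"
    by (simp add: fps_eq_iff)
  with F show ?thesis
    by simp
qed

section \<open>Expansions of the differences\<close>

text \<open>
  By the chain rule $x(1+x)\,\frac{d}{dx}A(w) = w\,A'(w) = B(w)$ for $w = cx/(1+x)$. With
  $c = 1+\mu$ and $c = 1$ this is the differential equation solved above.
\<close>

lemma polylog_moebius_diff_expansion:
  assumes A: "polylog_branch (Suc p) A" and B: "polylog_branch p B" and p: "p > 0"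
    and \<mu>: "norm \<mu> < 1"
    and G: "(\<lambda>x. B ((1 + \<mu>) * x / (1 + x)) - B (x / (1 + x))) has_fps_expansion G"
  shows "(\<lambda>x. A ((1 + \<mu>) * x / (1 + x)) - A (x / (1 + x))) has_fps_expansion
           Abs_fps (\<lambda>n. (-1) ^ (n - 1) / of_nat n * (\<Sum>k=1..n. (-1) ^ (k - 1) * fps_nth G k))"
proof (rule has_fps_expansion_solve_euler[OF _ _ _ G])
  have D: "((\<lambda>x. A ((1 + \<mu>) * x / (1 + x)) - A (x / (1 + x))) has_field_derivative
      (deriv A ((1 + \<mu>) * x / (1 + x)) * ((1 + \<mu>) / (1 + x)\<^sup>2)
        - deriv A (x / (1 + x)) * (1 / (1 + x)\<^sup>2))) (at x)"
    and ode: "x * (1 + x) * (deriv A ((1 + \<mu>) * x / (1 + x)) * ((1 + \<mu>) / (1 + x)\<^sup>2)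
        - deriv A (x / (1 + x)) * (1 / (1 + x)\<^sup>2))
      = B ((1 + \<mu>) * x / (1 + x)) - B (x / (1 + x))"
    if "x \<in> ball 0 1" for x
  proof -
    have x: "norm x < 1"
      using that by simp
    have nz: "1 + x \<noteq> 0"
      using x by (metis add_eq_0_iff norm_minus_cancel norm_one less_irrefl)
    have dom: "(1 + \<mu>) * x / (1 + x) \<in> Li3_domain" "x / (1 + x) \<in> Li3_domain"
      using moebius_in_Li3_domain[OF \<mu> x] moebius_in_Li3_domain[OF _ x, of 0] by auto
    have A': "(A has_field_derivative deriv A z) (at z)" if "z \<in> Li3_domain" for z
      using A open_Li3_domain that by (auto simp: polylog_branch_def intro: holomorphic_derivI)
    show "((\<lambda>x. A ((1 + \<mu>) * x / (1 + x)) - A (x / (1 + x))) has_field_derivative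
      (deriv A ((1 + \<mu>) * x / (1 + x)) * ((1 + \<mu>) / (1 + x)\<^sup>2)
        - deriv A (x / (1 + x)) * (1 / (1 + x)\<^sup>2))) (at x)"
      using moebius_has_field_derivative[OF A'[OF dom(1)] nz]
        moebius_has_field_derivative[of A _ 1 x, simplified, OF A'[OF dom(2)] nz]
      by (intro DERIV_diff) simp_all
    have "B ((1 + \<mu>) * x / (1 + x)) = x * (1 + x) * (deriv A ((1 + \<mu>) * x / (1 + x)) * ((1 + \<mu>) / (1 + x)\<^sup>2))"
      using nz by (subst polylog_branch_deriv[OF A B p dom(1), symmetric])
        (simp add: power2_eq_square)
    moreover have "B (x / (1 + x)) = x * (1 + x) * (deriv A (x / (1 + x)) * (1 / (1 + x)\<^sup>2))"
      using nz by (subst polylog_branch_deriv[OF A B p dom(2), symmetric])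
        (simp add: power2_eq_square)
    ultimately show "x * (1 + x) * (deriv A ((1 + \<mu>) * x / (1 + x)) * ((1 + \<mu>) / (1 + x)\<^sup>2)
        - deriv A (x / (1 + x)) * (1 / (1 + x)\<^sup>2))
      = B ((1 + \<mu>) * x / (1 + x)) - B (x / (1 + x))"
      by (simp only: right_diff_distrib)
  qed
  show "(\<lambda>x. A ((1 + \<mu>) * x / (1 + x)) - A (x / (1 + x))) holomorphic_on ball 0 1"
    unfolding holomorphic_on_open[OF open_ball] using D by blast
  show "x * (1 + x) * deriv (\<lambda>x. A ((1 + \<mu>) * x / (1 + x)) - A (x / (1 + x))) x
      = B ((1 + \<mu>) * x / (1 + x)) - B (x / (1 + x))" if "x \<in> ball 0 1" for x
    using DERIV_imp_deriv[OF D[OF that]] ode[OF that] by simp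
qed auto

text \<open>
  The arguments of the logarithms are $(1-\mu x)/(1+x)$ and $1/(1+x)$. Both $1-\mu x$ and $1+x$ lie
  in the right half-plane, so the principal logarithm of the first quotient splits without a
  $2\pi i$ correction. What remains is $-\ln(1-\mu x)$.
\<close>

lemma log_moebius_diff_expansion:
  fixes \<mu> :: complex
  assumes \<mu>: "norm \<mu> < 1"
  shows "(\<lambda>x. - ln (1 - (1 + \<mu>) * x / (1 + x)) - - ln (1 - x / (1 + x))) has_fps_expansion
           Abs_fps (\<lambda>n. \<mu> ^ n / of_nat n)"
proof (rule has_fps_expansionI)
  have "eventually (\<lambda>z. z \<in> ball 0 1) (nhds (0::complex))"
    by (intro eventually_nhds_in_open) auto
  then show "\<forall>\<^sub>F x in nhds 0. (\<lambda>n. fps_nth (Abs_fps (\<lambda>n. \<mu> ^ n / of_nat n)) n * x ^ n) sums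
      (- ln (1 - (1 + \<mu>) * x / (1 + x)) - - ln (1 - x / (1 + x)))"
  proof eventually_elim
    case (elim x)
    then have x: "norm x < 1"
      by simp
    have \<mu>x: "norm (\<mu> * x) < 1"
      using mult_strict_mono'[OF \<mu> x] by (simp add: norm_mult)
    have pos: "Re (1 - \<mu> * x) > 0" "Re (1 + x) > 0"
      using complex_Re_le_cmod[of "\<mu> * x"] \<mu>x abs_Re_le_cmod[of x] x by auto
    then have nz: "1 - \<mu> * x \<noteq> 0" "1 + x \<noteq> 0"
      by (metis less_irrefl zero_complex.simps(1))+
    have bnd: "\<bar>Im (Ln (1 - \<mu> * x))\<bar> < pi / 2" "\<bar>Im (Ln (1 + x))\<bar> < pi / 2"
      using pos Re_Ln_pos_lt_imp by auto
    have inv: "ln (inverse (1 + x)) = - ln (1 + x)"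
      by (rule Ln_inverse) (use pos in \<open>auto simp: complex_nonpos_Reals_iff\<close>)
    have "1 - (1 + \<mu>) * x / (1 + x) = (1 - \<mu> * x) * inverse (1 + x)"
      using nz(2) by (simp add: field_simps)
    also have "ln \<dots> = ln (1 - \<mu> * x) + ln (inverse (1 + x))"
      by (rule Ln_times_simple) (use nz bnd inv in auto)
    finally have 1: "ln (1 - (1 + \<mu>) * x / (1 + x)) = ln (1 - \<mu> * x) - ln (1 + x)"
      unfolding inv by simp
    have "1 - x / (1 + x) = inverse (1 + x)"
      using nz(2) by (simp add: field_simps)
    with inv have 2: "ln (1 - x / (1 + x)) = - ln (1 + x)"
      by simp
    have "(\<lambda>n. (\<mu> * x) ^ n / of_nat n) sums - ln (1 - \<mu> * x)"
      using sums_minus[OF Ln_series'[of "- (\<mu> * x)"]] \<mu>x by simp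
    then show ?case
      unfolding 1 2 by (simp add: power_mult_distrib)
  qed
qed

theorem proposition11:
  fixes \<mu> x :: complex
  assumes "norm \<mu> < 1" and "norm x < 1"
  shows "(\<lambda>m. (\<Sum>k=1..Suc m. H_minus k \<mu> / of_nat k) * ((-1) ^ m / of_nat (Suc m)) * x ^ Suc m)
           sums (Li3 ((1 + \<mu>) * x / (1 + x)) - Li3 (x / (1 + x)))"
proof -
  obtain Li2 where Li2: "polylog_branch 2 Li2"
    using polylog_branch_ex[of 1] by (auto simp: numeral_2_eq_2)
  define f where "f = (\<lambda>x. Li3_extension ((1 + \<mu>) * x / (1 + x)) - Li3_extension (x / (1 + x)))"
  have "(\<lambda>x. Li2 ((1 + \<mu>) * x / (1 + x)) - Li2 (x / (1 + x))) has_fps_expansion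
      Abs_fps (\<lambda>n. (-1) ^ (n - 1) / of_nat n * H_minus n \<mu>)"
    using polylog_moebius_diff_expansion[OF _ polylog_branch_1 _ assms(1)
        log_moebius_diff_expansion[OF assms(1)], of Li2] Li2
    by (simp add: H_minus_def numeral_2_eq_2)
  from polylog_moebius_diff_expansion[OF _ Li2 _ assms(1) this, of Li3_extension]
  have "f has_fps_expansion Abs_fps (\<lambda>n. (-1) ^ (n - 1) / of_nat n *
      (\<Sum>k=1..n. (-1) ^ (k - 1) * ((-1) ^ (k - 1) / of_nat k * H_minus k \<mu>)))"
    using polylog_branch_Li3_extension by (simp add: f_def numeral_3_eq_3 numeral_2_eq_2)
  \<comment> \<open>The sign produced by the first inversion cancels the one introduced by the second.\<close>
  also have "(\<lambda>n. (-1) ^ (n - 1) / of_nat n *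
      (\<Sum>k=1..n. (-1) ^ (k - 1) * ((-1) ^ (k - 1) / of_nat k * H_minus k \<mu>)))
      = (\<lambda>n. (-1) ^ (n - 1) / of_nat n * (\<Sum>k=1..n. H_minus k \<mu> / of_nat k))"
    by (simp flip: mult.assoc power_mult_distrib)
  finally have exp: "f has_fps_expansion
      Abs_fps (\<lambda>n. (-1) ^ (n - 1) / of_nat n * (\<Sum>k=1..n. H_minus k \<mu> / of_nat k))" .
  have dom: "(1 + \<mu>) * x / (1 + x) \<in> Li3_domain" "x / (1 + x) \<in> Li3_domain"
    if "norm x < 1" for x
    using moebius_in_Li3_domain[OF assms(1) that] moebius_in_Li3_domain[OF _ that, of 0] by auto
  have "f holomorphic_on ball 0 1"
  proof -
    have nz: "1 + x \<noteq> 0" if "x \<in> ball 0 1" for x :: complex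
      using that by (metis add_eq_0_iff norm_minus_cancel norm_one less_irrefl mem_ball_0)
    have ext: "(Li3_extension \<circ> w) holomorphic_on ball 0 1"
      if "w holomorphic_on ball 0 1" "w ` ball 0 1 \<subseteq> Li3_domain" for w
      using that is_Li3_extension_Li3_extension
      by (auto simp: is_Li3_extension_def intro: holomorphic_on_compose_gen)
    show ?thesis
      unfolding f_def using nz dom
      by (intro holomorphic_on_diff ext[unfolded comp_def] holomorphic_intros) auto
  qed
  then have "(\<lambda>n. fps_nth (Abs_fps (\<lambda>n. (-1) ^ (n - 1) / of_nat n *
      (\<Sum>k=1..n. H_minus k \<mu> / of_nat k))) n * x ^ n) sums f x"
    by (intro has_fps_expansion_imp_sums_complex[OF exp, where r = 1])
      (use assms in \<open>auto simp: eball_def ball_def dist_norm\<close>)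
  \<comment> \<open>The term with index $0$ vanishes, so the summation may start at $1$.\<close>
  then have "(\<lambda>m. fps_nth (Abs_fps (\<lambda>n. (-1) ^ (n - 1) / of_nat n *
      (\<Sum>k=1..n. H_minus k \<mu> / of_nat k))) (Suc m) * x ^ Suc m) sums f x"
    by (subst sums_Suc_iff) simp
  then have "(\<lambda>m. (-1) ^ m / of_nat (Suc m) * (\<Sum>k=1..Suc m. H_minus k \<mu> / of_nat k) * x ^ Suc m) sums f x"
    by (simp only: fps_nth_Abs_fps diff_Suc_1)
  moreover have "f x = Li3 ((1 + \<mu>) * x / (1 + x)) - Li3 (x / (1 + x))"
    using dom[OF assms(2)] by (simp add: f_def Li3_eq_extension)
  ultimately show ?thesis
    by (simp only: mult_ac)
qed

end
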